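(* Let $\mathbb{A}$ be a PCA and let $\mathbb{A}'$ be an elementary sub-PCA of $\mathbb{A}$. The strong Weihrauch doctrine $\mathfrak{SW}$ is isomorphic to the pure existential completion of the elementary strong Weihrauch doctrine $\mathfrak{sW}$: $$\mathfrak{SW}\equiv\mathfrak{sW}^{\exists}.$$
   Context: A partial combinatory algebra (PCA) is a set $\mathbb{A}$ with a partial binary operation $\cdot$ (application, associating to the left; $ab\downarrow$ means that $ab$ is defined; $x\simeq y$ means that $x$ is defined whenever $y$ is, in which case they are equal) for which there exist $k,s\in\mathbb{A}$ such that for all $a,b,c\in\mathbb{A}$: $ka\downarrow$, $kab\simeq a$, $sa\downarrow$, $sab\downarrow$, $sabc\simeq ac(bc)$. An elementary sub-PCA is a subset $\mathbb{A}'\subseteq\mathbb{A}$ closed under (defined) application that contains elements $k,s$ such that $ka\downarrow$, $kab\simeq a$, $sa\downarrow$, $sab\downarrow$ and $sabc\simeq ac(bc)$ for all $a,b,c\in\mathbb{A}$. Fix pairing and projection elements $\mathsf{pair},\mathsf{fst},\mathsf{snd}\in\mathbb{A}'$ with $\mathsf{fst}\cdot(\mathsf{pair}\,a\,b)=a$, $\mathsf{snd}\cdot(\mathsf{pair}\,a\,b)=b$, and write $\langle a,b\rangle:=\mathsf{pair}\,a\,b$. $\wp^*(\mathbb{A})$ is the set of nonempty subsets of $\mathbb{A}$. Assertions such as $a\cdot b\in S$ include that $a\cdot b$ is defined. $\mathsf{Mod}_{\mathsf p}(\mathbb{A},\mathbb{A}')$ is the category with objects the subsets $X\subseteq\mathbb{A}$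 and morphisms $X\to Y$ the computable functions, i.e. the functions $f\colon X\to Y$ for which there is $a\in\mathbb{A}'$ with $a\cdot x\downarrow$ and $f(x)=a\cdot x$ for all $x\in X$. Its products are $X\times Y=\{\langle x,y\rangle:x\in X,y\in Y\}$. With abuse of notation, $\overline k\cdot p$ denotes the value at $p$ of a computable function $\overline k$. A doctrine is a functor $P\colon\mathcal{C}^{\mathrm{op}}\to\mathsf{Pos}$ with $\mathcal{C}$ having finite products; an isomorphism of doctrines on the same base is a natural family of poset isomorphisms. Pure existential completion: $P^{\exists}(A)$ is the poset reflection of the preorder of pairs $(\pi,\alpha)$ with $\pi\colon A\times B\to A$ a product projection and $\alpha\in P(A\times B)$, where $(\pi\colon A\times B\to A,\alpha)\le_\exists(\pi'\colon A\times C\to A,\beta)$ iff there is $h\colon A\times B\to A\times C$ with $\pi'h=\pi$ and $\alpha\le P_h(\beta)$. It acts on a morphism $u\colon A'\to A$ by pulling back: $(\pi\colon A\times B\to A,\alpha)\mapsto(A'\times B\to A',P_{u\times\mathrm{id}_B}(\alpha))$. Elementary strong Weihrauch doctrine $\mathfrak{sW}\colon\mathsf{Mod}_{\mathsf p}(\mathbb{A},\mathbb{A}')^{\mathrm{op}}\to\mathsf{Pos}$: $\mathfrak{sW}(X)$ is the poset reflection of the set of functions $X\to\wp^*(\mathbb{A})$ preordered by $f\le_{\mathsf{dsW}}g$ iff there is $\overline h\in\mathbb{A}'$ with $(\forall p\in X)(\forall q\in g(p))(\overline h\cdot q\in f(p))$; it acts by precomposition. Strong Weihrauch doctrine $\mathfrak{SW}\colon\mathsf{Mod}_{\mathsf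 p}(\mathbb{A},\mathbb{A}')^{\mathrm{op}}\to\mathsf{Pos}$: $\mathfrak{SW}(X)$ is the poset reflection of the preorder whose objects are generalized Weihrauch predicates on $X$, i.e. functions $F\colon X\to\wp^*(\mathbb{A})^Y$ for some $Y\subseteq\mathbb{A}$ (write $F(x,y)=F(x)(y)$), with $F\le_{\mathsf{sW}}G$, for $F\colon X\to\wp^*(\mathbb{A})^Y$ and $G\colon X\to\wp^*(\mathbb{A})^Z$, iff there are a computable function $\overline k\colon X\times Y\to Z$ and $\overline h\in\mathbb{A}'$ such that $(\forall\langle x,y\rangle\in X\times Y)(\forall q\in G(x,\overline k\cdot\langle x,y\rangle))(\overline h\cdot q\in F(x,y))$. It acts by precomposition. *)

theory Defs
  imports Main "HOL-Library.FuncSet"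
begin

section \<open>Categories with finite products\<close>

record ('o, 'm) category =
  Obj :: "'o set"
  Arr :: "'m set"
  Dom :: "'m \<Rightarrow> 'o"
  Cod :: "'m \<Rightarrow> 'o"
  Ident :: "'o \<Rightarrow> 'm"
  Comp :: "'m \<Rightarrow> 'm \<Rightarrow> 'm"  \<comment> \<open>\<open>Comp C g f\<close> is \<open>g\<close> after \<open>f\<close>\<close>

definition hom :: "('o, 'm, 'x) category_scheme \<Rightarrow> 'o \<Rightarrow> 'o \<Rightarrow> 'm set" where
  "hom C A B = {f \<in> Arr C. Dom C f = A \<and> Cod C f = B}"

definition is_category :: "('o, 'm, 'x) category_scheme \<Rightarrow> bool" where
  "is_category C \<longleftrightarrow>
     (\<forall>f\<in>Arr C. Dom C f \<in> Obj C \<and> Cod C f \<in> Obj C) \<and>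
     (\<forall>A\<in>Obj C. Ident C A \<in> hom C A A) \<and>
     (\<forall>f\<in>Arr C. \<forall>g\<in>Arr C. Cod C f = Dom C g \<longrightarrow> Comp C g f \<in> hom C (Dom C f) (Cod C g)) \<and>
     (\<forall>f\<in>Arr C. Comp C f (Ident C (Dom C f)) = f \<and> Comp C (Ident C (Cod C f)) f = f) \<and>
     (\<forall>f\<in>Arr C. \<forall>g\<in>Arr C. \<forall>h\<in>Arr C. Cod C f = Dom C g \<longrightarrow> Cod C g = Dom C h \<longrightarrow>
        Comp C h (Comp C g f) = Comp C (Comp C h g) f)"

record ('o, 'm) prod_category = "('o, 'm) category" +
  Prod :: "'o \<Rightarrow> 'o \<Rightarrow> 'o"
  Pr1 :: "'o \<Rightarrow> 'o \<Rightarrow> 'm"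
  Pr2 :: "'o \<Rightarrow> 'o \<Rightarrow> 'm"

definition is_product ::
  "('o, 'm, 'x) category_scheme \<Rightarrow> 'o \<Rightarrow> 'o \<Rightarrow> 'o \<Rightarrow> 'm \<Rightarrow> 'm \<Rightarrow> bool" where
  "is_product C A B Q p q \<longleftrightarrow>
     Q \<in> Obj C \<and> p \<in> hom C Q A \<and> q \<in> hom C Q B \<and>
     (\<forall>T\<in>Obj C. \<forall>f\<in>hom C T A. \<forall>g\<in>hom C T B.
        \<exists>!m. m \<in> hom C T Q \<and> Comp C p m = f \<and> Comp C q m = g)"

definition is_terminal :: "('o, 'm, 'x) category_scheme \<Rightarrow> 'o \<Rightarrow> bool" where
  "is_terminal C T \<longleftrightarrow> T \<in> Obj C \<and> (\<forall>A\<in>Obj C. \<exists>!f. f \<in> hom C A T)"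

definition has_finite_products :: "('o, 'm, 'x) prod_category_scheme \<Rightarrow> bool" where
  "has_finite_products C \<longleftrightarrow>
     is_category C \<and> (\<exists>T. is_terminal C T) \<and>
     (\<forall>A\<in>Obj C. \<forall>B\<in>Obj C. is_product C A B (Prod C A B) (Pr1 C A B) (Pr2 C A B))"

definition prod_map :: "('o, 'm, 'x) prod_category_scheme \<Rightarrow> 'm \<Rightarrow> 'm \<Rightarrow> 'm" where
  "prod_map C f g =
     (THE m. m \<in> hom C (Prod C (Dom C f) (Dom C g)) (Prod C (Cod C f) (Cod C g)) \<and>
        Comp C (Pr1 C (Cod C f) (Cod C g)) m = Comp C f (Pr1 C (Dom C f) (Dom C g)) \<and>
        Comp C (Pr2 C (Cod C f) (Cod C g)) m = Comp C g (Pr2 C (Dom C f) (Dom C g)))"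

section \<open>Doctrines\<close>

text \<open>The data of a contravariant assignment of preorders to the objects and of maps
  to the arrows of a category; the laws are imposed by \<open>is_doctrine\<close>.\<close>

record ('o, 'm, 'f) indexed_preorder =
  fib :: "'o \<Rightarrow> 'f set"
  le :: "'o \<Rightarrow> 'f rel"
  rdx :: "'m \<Rightarrow> 'f \<Rightarrow> 'f"

definition is_doctrine ::
  "('o, 'm, 'x) prod_category_scheme \<Rightarrow> ('o, 'm, 'f) indexed_preorder \<Rightarrow> bool" where
  "is_doctrine C P \<longleftrightarrow>
     has_finite_products C \<and>
     (\<forall>A\<in>Obj C. partial_order_on (fib P A) (le P A)) \<and>
     (\<forall>u\<in>Arr C. \<forall>a\<in>fib P (Cod C u). rdx P u a \<in> fib P (Dom C u)) \<and>
     (\<forall>u\<in>Arr C. \<forall>(a, b)\<in>le P (Cod C u). (rdx P u a, rdx P u b) \<in> le P (Dom C u)) \<and>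
     (\<forall>A\<in>Obj C. \<forall>a\<in>fib P A. rdx P (Ident C A) a = a) \<and>
     (\<forall>u\<in>Arr C. \<forall>v\<in>Arr C. Cod C u = Dom C v \<longrightarrow>
        (\<forall>a\<in>fib P (Cod C v). rdx P (Comp C v u) a = rdx P u (rdx P v a)))"

definition isomorphic_doctrines ::
  "('o, 'm, 'x) prod_category_scheme \<Rightarrow>
   ('o, 'm, 'f) indexed_preorder \<Rightarrow> ('o, 'm, 'g) indexed_preorder \<Rightarrow> bool" where
  "isomorphic_doctrines C P Q \<longleftrightarrow>
     is_doctrine C P \<and> is_doctrine C Q \<and>
     (\<exists>\<theta> :: 'o \<Rightarrow> 'f \<Rightarrow> 'g.
        (\<forall>A\<in>Obj C.
           bij_betw (\<theta> A) (fib P A) (fib Q A) \<and>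
           (\<forall>a\<in>fib P A. \<forall>b\<in>fib P A. (a, b) \<in> le P A \<longleftrightarrow> (\<theta> A a, \<theta> A b) \<in> le Q A)) \<and>
        (\<forall>u\<in>Arr C. \<forall>a\<in>fib P (Cod C u). \<theta> (Dom C u) (rdx P u a) = rdx Q u (\<theta> (Cod C u) a)))"

definition equiv_of :: "('o, 'm, 'f) indexed_preorder \<Rightarrow> 'o \<Rightarrow> 'f rel" where
  "equiv_of P A = le P A \<inter> (le P A)\<inverse>"

text \<open>Fibrewise poset reflection. For monotone reindexing, the action on the class of \<open>a\<close>
  is the class of \<open>rdx P u a\<close>.\<close>

definition poset_reflection ::
  "('o, 'm, 'x) category_scheme \<Rightarrow> ('o, 'm, 'f) indexed_preorder \<Rightarrow>
   ('o, 'm, 'f set) indexed_preorder" where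
  "poset_reflection C P =
     \<lparr>fib = (\<lambda>A. fib P A // equiv_of P A),
      le = (\<lambda>A. {(c, d). c \<in> fib P A // equiv_of P A \<and> d \<in> fib P A // equiv_of P A \<and>
                   (\<exists>a\<in>c. \<exists>b\<in>d. (a, b) \<in> le P A)}),
      rdx = (\<lambda>u c. equiv_of P (Dom C u) `` (rdx P u ` c))\<rparr>"

section \<open>Pure existential completion\<close>

text \<open>A pair consisting of a projection \<open>A \<times> B \<rightarrow> A\<close> and an element \<open>\<alpha>\<close> over \<open>A \<times> B\<close> is
  recorded as \<open>(B, \<alpha>)\<close>: the projection is the chosen one, \<open>Pr1 C A B\<close>.\<close>

definition ex_elements ::
  "('o, 'm, 'x) prod_category_scheme \<Rightarrow> ('o, 'm, 'f) indexed_preorder \<Rightarrow> 'o \<Rightarrow> ('o \<times> 'f) set" where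
  "ex_elements C P A = {(B, \<alpha>). B \<in> Obj C \<and> \<alpha> \<in> fib P (Prod C A B)}"

definition ex_preorder ::
  "('o, 'm, 'x) prod_category_scheme \<Rightarrow> ('o, 'm, 'f) indexed_preorder \<Rightarrow>
   ('o, 'm, 'o \<times> 'f) indexed_preorder" where
  "ex_preorder C P =
     \<lparr>fib = ex_elements C P,
      le = (\<lambda>A. {((B, \<alpha>), (D, \<beta>)).
                   (B, \<alpha>) \<in> ex_elements C P A \<and> (D, \<beta>) \<in> ex_elements C P A \<and>
                   (\<exists>h\<in>hom C (Prod C A B) (Prod C A D).
                      Comp C (Pr1 C A D) h = Pr1 C A B \<and>
                      (\<alpha>, rdx P h \<beta>) \<in> le P (Prod C A B))}),
      rdx = (\<lambda>u (B, \<alpha>). (B, rdx P (prod_map C u (Ident C B)) \<alpha>))\<rparr>"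

definition pure_existential_completion ::
  "('o, 'm, 'x) prod_category_scheme \<Rightarrow> ('o, 'm, 'f) indexed_preorder \<Rightarrow>
   ('o, 'm, ('o \<times> 'f) set) indexed_preorder" where
  "pure_existential_completion C P = poset_reflection C (ex_preorder C P)"

section \<open>Partial combinatory algebras\<close>

text \<open>The underlying set of the algebra is the type \<open>'a\<close>; \<open>None\<close> means undefined.\<close>

type_synonym 'a papp = "'a \<Rightarrow> 'a \<Rightarrow> 'a option"

definition oapp :: "'a papp \<Rightarrow> 'a option \<Rightarrow> 'a option \<Rightarrow> 'a option" where
  "oapp app x y = Option.bind x (\<lambda>a. Option.bind y (\<lambda>b. app a b))"

text \<open>\<open>x \<simeq> y\<close> in the one-sided sense: \<open>x\<close> may be defined when \<open>y\<close> is not.\<close>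

definition kleene_eq :: "'a option \<Rightarrow> 'a option \<Rightarrow> bool" (infix "\<simeq>" 50) where
  "x \<simeq> y \<longleftrightarrow> (y \<noteq> None \<longrightarrow> x = y)"

definition ks_combinators :: "'a papp \<Rightarrow> 'a \<Rightarrow> 'a \<Rightarrow> bool" where
  "ks_combinators app k s \<longleftrightarrow>
     (\<forall>a b c.
        app k a \<noteq> None \<and>
        oapp app (app k a) (Some b) \<simeq> Some a \<and>
        app s a \<noteq> None \<and>
        oapp app (app s a) (Some b) \<noteq> None \<and>
        oapp app (oapp app (app s a) (Some b)) (Some c) \<simeq> oapp app (app a c) (app b c))"

definition pca :: "'a papp \<Rightarrow> bool" where
  "pca app \<longleftrightarrow> (\<exists>k s. ks_combinators app k s)"

definition elementary_sub_pca :: "'a papp \<Rightarrow> 'a set \<Rightarrow> bool" where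
  "elementary_sub_pca app A' \<longleftrightarrow>
     (\<forall>a\<in>A'. \<forall>b\<in>A'. \<forall>c. app a b = Some c \<longrightarrow> c \<in> A') \<and>
     (\<exists>k\<in>A'. \<exists>s\<in>A'. ks_combinators app k s)"

definition pairing_elements :: "'a papp \<Rightarrow> 'a set \<Rightarrow> 'a \<Rightarrow> 'a \<Rightarrow> 'a \<Rightarrow> bool" where
  "pairing_elements app A' pr p1 p2 \<longleftrightarrow>
     pr \<in> A' \<and> p1 \<in> A' \<and> p2 \<in> A' \<and>
     (\<forall>a b. oapp app (Some p1) (oapp app (app pr a) (Some b)) = Some a \<and>
            oapp app (Some p2) (oapp app (app pr a) (Some b)) = Some b)"

definition tuple :: "'a papp \<Rightarrow> 'a \<Rightarrow> 'a \<Rightarrow> 'a \<Rightarrow> 'a" where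
  "tuple app pr a b = the (oapp app (app pr a) (Some b))"

definition app_in :: "'a papp \<Rightarrow> 'a \<Rightarrow> 'a \<Rightarrow> 'a set \<Rightarrow> bool" where
  "app_in app a b S \<longleftrightarrow> (\<exists>c\<in>S. app a b = Some c)"

section \<open>The category of subsets and computable functions\<close>

definition computable_funs :: "'a papp \<Rightarrow> 'a set \<Rightarrow> 'a set \<Rightarrow> 'a set \<Rightarrow> ('a \<Rightarrow> 'a) set" where
  "computable_funs app A' X Y = {f \<in> X \<rightarrow>\<^sub>E Y. \<exists>a\<in>A'. \<forall>x\<in>X. app a x = Some (f x)}"

definition pca_prod :: "'a papp \<Rightarrow> 'a \<Rightarrow> 'a set \<Rightarrow> 'a set \<Rightarrow> 'a set" where
  "pca_prod app pr X Y = {tuple app pr x y | x y. x \<in> X \<and> y \<in> Y}"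

datatype 'a arrow = Arrow (src: "'a set") (fn: "'a \<Rightarrow> 'a") (tgt: "'a set")

definition Mod_p ::
  "'a papp \<Rightarrow> 'a set \<Rightarrow> 'a \<Rightarrow> 'a \<Rightarrow> 'a \<Rightarrow> ('a set, 'a arrow) prod_category" where
  "Mod_p app A' pr p1 p2 =
     \<lparr>Obj = UNIV,
      Arr = {f. fn f \<in> computable_funs app A' (src f) (tgt f)},
      Dom = src,
      Cod = tgt,
      Ident = (\<lambda>X. Arrow X (\<lambda>x\<in>X. x) X),
      Comp = (\<lambda>g f. Arrow (src f) (compose (src f) (fn g) (fn f)) (tgt g)),
      Prod = pca_prod app pr,
      Pr1 = (\<lambda>X Y. Arrow (pca_prod app pr X Y) (\<lambda>z\<in>pca_prod app pr X Y. the (app p1 z)) X),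
      Pr2 = (\<lambda>X Y. Arrow (pca_prod app pr X Y) (\<lambda>z\<in>pca_prod app pr X Y. the (app p2 z)) Y)\<rparr>"

section \<open>The strong Weihrauch doctrines\<close>

definition nonempty_sets :: "'a set set" where
  "nonempty_sets = {S. S \<noteq> {}}"

definition sW_preorder ::
  "'a papp \<Rightarrow> 'a set \<Rightarrow> ('a set, 'a arrow, 'a \<Rightarrow> 'a set) indexed_preorder" where
  "sW_preorder app A' =
     \<lparr>fib = (\<lambda>X. X \<rightarrow>\<^sub>E nonempty_sets),
      le = (\<lambda>X. {(f, g). f \<in> X \<rightarrow>\<^sub>E nonempty_sets \<and> g \<in> X \<rightarrow>\<^sub>E nonempty_sets \<and>
                   (\<exists>h\<in>A'. \<forall>p\<in>X. \<forall>q\<in>g p. app_in app h q (f p))}),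
      rdx = (\<lambda>u f. compose (src u) f (fn u))\<rparr>"

definition elementary_strong_Weihrauch ::
  "'a papp \<Rightarrow> 'a set \<Rightarrow> 'a \<Rightarrow> 'a \<Rightarrow> 'a \<Rightarrow>
   ('a set, 'a arrow, ('a \<Rightarrow> 'a set) set) indexed_preorder" where
  "elementary_strong_Weihrauch app A' pr p1 p2 =
     poset_reflection (Mod_p app A' pr p1 p2) (sW_preorder app A')"

text \<open>A generalized Weihrauch predicate carries its set \<open>Y\<close> explicitly, since \<open>Y\<close> cannot be
  recovered from the function when \<open>X\<close> is empty.\<close>

definition gen_Weihrauch_preds :: "'a set \<Rightarrow> ('a set \<times> ('a \<Rightarrow> 'a \<Rightarrow> 'a set)) set" where
  "gen_Weihrauch_preds X = {(Y, F). F \<in> X \<rightarrow>\<^sub>E (Y \<rightarrow>\<^sub>E nonempty_sets)}"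

definition SW_preorder ::
  "'a papp \<Rightarrow> 'a set \<Rightarrow> 'a \<Rightarrow>
   ('a set, 'a arrow, 'a set \<times> ('a \<Rightarrow> 'a \<Rightarrow> 'a set)) indexed_preorder" where
  "SW_preorder app A' pr =
     \<lparr>fib = gen_Weihrauch_preds,
      le = (\<lambda>X. {((Y, F), (Z, G)).
                   (Y, F) \<in> gen_Weihrauch_preds X \<and> (Z, G) \<in> gen_Weihrauch_preds X \<and>
                   (\<exists>k\<in>computable_funs app A' (pca_prod app pr X Y) Z. \<exists>h\<in>A'.
                      \<forall>x\<in>X. \<forall>y\<in>Y. \<forall>q\<in>G x (k (tuple app pr x y)). app_in app h q (F x y))}),
      rdx = (\<lambda>u (Y, F). (Y, compose (src u) F (fn u)))\<rparr>"

definition strong_Weihrauch ::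
  "'a papp \<Rightarrow> 'a set \<Rightarrow> 'a \<Rightarrow> 'a \<Rightarrow> 'a \<Rightarrow>
   ('a set, 'a arrow, ('a set \<times> ('a \<Rightarrow> 'a \<Rightarrow> 'a set)) set) indexed_preorder" where
  "strong_Weihrauch app A' pr p1 p2 =
     poset_reflection (Mod_p app A' pr p1 p2) (SW_preorder app A' pr)"

end

theory Submission
  imports Defs
begin

text \<open>The set \<open>Y\<close> of a generalized Weihrauch predicate \<open>(Y, F)\<close> over \<open>X\<close> is the fibre of a
  projection \<open>X \<times> Y \<rightarrow> X\<close>, and \<open>F\<close> itself, uncurried, is a predicate on \<open>X \<times> Y\<close>. A computable
  \<open>k : X \<times> Y \<rightarrow> Z\<close> is the same thing as a morphism \<open>X \<times> Y \<rightarrow> X \<times> Z\<close> over \<open>X\<close>, so uncurrying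
  preserves and reflects the preorders; it is a bijection on representatives and strictly natural.
  The laws of the strong Weihrauch doctrine are transported back along it from those of the
  existential completion.\<close>

section \<open>Doctrines valued in preorders\<close>

text \<open>The two sides are quotiented a different number of times. In the completion, predicates
  on a product are first identified up to equivalence, and sets paired with such classes are then
  identified again; the strong Weihrauch doctrine is a single quotient. The comparison is therefore
  made before the outer quotients, between preorders whose functor laws hold as equalities of
  representatives. Passing to the inner classes costs injectivity, but this does no harm: a map that
  reflects the order can only merge elements that are already equivalent. A second obstacle is that
  the product of two arrows is a definite description, so both the laws of the completion and
  naturality must be extracted from the universal property.\<close>

locale product_category =
  fixes C :: "('o, 'm, 'x) prod_category_scheme"
  assumes has_products: "has_finite_products C"
begin

section \<open>Calculus of the chosen binary products\<close>

lemma category: "is_category C"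
  using has_products by (simp add: has_finite_products_def)

lemma hom_obj: "f \<in> hom C A B \<Longrightarrow> A \<in> Obj C \<and> B \<in> Obj C"
  using category by (auto simp: is_category_def hom_def)

lemma ident_hom: "A \<in> Obj C \<Longrightarrow> Ident C A \<in> hom C A A"
  using category by (auto simp: is_category_def)

lemma comp_hom: "g \<in> hom C B D \<Longrightarrow> f \<in> hom C A B \<Longrightarrow> Comp C g f \<in> hom C A D"
  using category by (auto simp: is_category_def hom_def)

lemma comp_ident: "f \<in> hom C A B \<Longrightarrow> Comp C f (Ident C A) = f"
  using category by (auto simp: is_category_def hom_def)

lemma ident_comp: "f \<in> hom C A B \<Longrightarrow> Comp C (Ident C B) f = f"
  using category by (auto simp: is_category_def hom_def)

lemma comp_assoc:
  "h \<in> hom C D E \<Longrightarrow> g \<in> hom C B D \<Longrightarrow> f \<in> hom C A B \<Longrightarrow>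
   Comp C h (Comp C g f) = Comp C (Comp C h g) f"
  using category by (auto simp: is_category_def hom_def)

lemma product:
  "A \<in> Obj C \<Longrightarrow> B \<in> Obj C \<Longrightarrow> is_product C A B (Prod C A B) (Pr1 C A B) (Pr2 C A B)"
  using has_products by (simp add: has_finite_products_def)

lemma prod_obj: "A \<in> Obj C \<Longrightarrow> B \<in> Obj C \<Longrightarrow> Prod C A B \<in> Obj C"
  and pr1_hom: "A \<in> Obj C \<Longrightarrow> B \<in> Obj C \<Longrightarrow> Pr1 C A B \<in> hom C (Prod C A B) A"
  and pr2_hom: "A \<in> Obj C \<Longrightarrow> B \<in> Obj C \<Longrightarrow> Pr2 C A B \<in> hom C (Prod C A B) B"
  using product by (auto simp: is_product_def)

lemma pairing_ex1:
  "f \<in> hom C T A \<Longrightarrow> g \<in> hom C T B \<Longrightarrow>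
   \<exists>!m. m \<in> hom C T (Prod C A B) \<and> Comp C (Pr1 C A B) m = f \<and> Comp C (Pr2 C A B) m = g"
  using product[of A B] hom_obj[of f T A] hom_obj[of g T B] unfolding is_product_def by blast

lemma prod_eqI:
  assumes m: "m \<in> hom C T (Prod C A B)" and m': "m' \<in> hom C T (Prod C A B)"
    and AB: "A \<in> Obj C" "B \<in> Obj C"
    and "Comp C (Pr1 C A B) m = Comp C (Pr1 C A B) m'"
    and "Comp C (Pr2 C A B) m = Comp C (Pr2 C A B) m'"
  shows "m = m'"
proof -
  have "Comp C (Pr1 C A B) m \<in> hom C T A" "Comp C (Pr2 C A B) m \<in> hom C T B"
    using comp_hom pr1_hom pr2_hom AB m by blast+
  from pairing_ex1[OF this] show ?thesis using assms by metis
qed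

text \<open>Nothing is known about the definite description \<open>prod_map\<close> until the
  universal property supplies existence and uniqueness. From here on only its typing and its two
  projection equations are used.\<close>

lemma
  assumes u: "u \<in> hom C A A'" and v: "v \<in> hom C B B'"
  shows prod_map_hom: "prod_map C u v \<in> hom C (Prod C A B) (Prod C A' B')"
    and pr1_prod_map: "Comp C (Pr1 C A' B') (prod_map C u v) = Comp C u (Pr1 C A B)"
    and pr2_prod_map: "Comp C (Pr2 C A' B') (prod_map C u v) = Comp C v (Pr2 C A B)"
proof -
  have "Comp C u (Pr1 C A B) \<in> hom C (Prod C A B) A'" "Comp C v (Pr2 C A B) \<in> hom C (Prod C A B) B'"
    using comp_hom pr1_hom pr2_hom u v hom_obj by meson+
  note ex1 = pairing_ex1[OF this]
  have *: "Dom C u = A" "Cod C u = A'" "Dom C v = B" "Cod C v = B'"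
    using u v by (auto simp: hom_def)
  from theI'[OF ex1]
  show "prod_map C u v \<in> hom C (Prod C A B) (Prod C A' B')"
    and "Comp C (Pr1 C A' B') (prod_map C u v) = Comp C u (Pr1 C A B)"
    and "Comp C (Pr2 C A' B') (prod_map C u v) = Comp C v (Pr2 C A B)"
    by (auto simp: prod_map_def *)
qed

lemma prod_map_ident:
  assumes "A \<in> Obj C" "B \<in> Obj C"
  shows "prod_map C (Ident C A) (Ident C B) = Ident C (Prod C A B)"
proof (rule prod_eqI[where T = "Prod C A B" and A = A and B = B])
  note hs = ident_hom[OF assms(1)] ident_hom[OF assms(2)]
  show "prod_map C (Ident C A) (Ident C B) \<in> hom C (Prod C A B) (Prod C A B)"
    using hs by (rule prod_map_hom)
  show "Comp C (Pr1 C A B) (prod_map C (Ident C A) (Ident C B)) =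
        Comp C (Pr1 C A B) (Ident C (Prod C A B))"
    using assms by (simp add: pr1_prod_map[OF hs] ident_comp[OF pr1_hom] comp_ident[OF pr1_hom])
  show "Comp C (Pr2 C A B) (prod_map C (Ident C A) (Ident C B)) =
        Comp C (Pr2 C A B) (Ident C (Prod C A B))"
    using assms by (simp add: pr2_prod_map[OF hs] ident_comp[OF pr2_hom] comp_ident[OF pr2_hom])
qed (use assms in \<open>auto intro: ident_hom prod_obj\<close>)

lemma prod_map_comp:
  assumes u: "u \<in> hom C A A'" and v: "v \<in> hom C A' A''" and B: "B \<in> Obj C"
  shows "prod_map C (Comp C v u) (Ident C B) =
         Comp C (prod_map C v (Ident C B)) (prod_map C u (Ident C B))"
proof (rule prod_eqI[where T = "Prod C A B" and A = A'' and B = B])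
  note i = ident_hom[OF B]
  have A: "A \<in> Obj C" "A' \<in> Obj C" "A'' \<in> Obj C" using u v hom_obj by blast+
  note vu = comp_hom[OF v u]
  note pu = prod_map_hom[OF u i] and pv = prod_map_hom[OF v i]
  note p = pr1_hom[OF A(1) B] pr1_hom[OF A(2) B] pr1_hom[OF A(3) B]
  note q = pr2_hom[OF A(1) B] pr2_hom[OF A(2) B] pr2_hom[OF A(3) B]
  show "A'' \<in> Obj C" by fact
  show "prod_map C (Comp C v u) (Ident C B) \<in> hom C (Prod C A B) (Prod C A'' B)"
    using vu i by (rule prod_map_hom)
  show "Comp C (prod_map C v (Ident C B)) (prod_map C u (Ident C B))
          \<in> hom C (Prod C A B) (Prod C A'' B)"
    using pv pu by (rule comp_hom)
  show "Comp C (Pr1 C A'' B) (prod_map C (Comp C v u) (Ident C B)) =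
        Comp C (Pr1 C A'' B) (Comp C (prod_map C v (Ident C B)) (prod_map C u (Ident C B)))"
    by (simp add: comp_assoc[OF p(3) pv pu] pr1_prod_map[OF v i] pr1_prod_map[OF vu i]
        comp_assoc[OF v p(2) pu, symmetric] pr1_prod_map[OF u i] comp_assoc[OF v u p(1)])
  show "Comp C (Pr2 C A'' B) (prod_map C (Comp C v u) (Ident C B)) =
        Comp C (Pr2 C A'' B) (Comp C (prod_map C v (Ident C B)) (prod_map C u (Ident C B)))"
    by (simp add: comp_assoc[OF q(3) pv pu] pr2_prod_map[OF v i] pr2_prod_map[OF vu i]
        comp_assoc[OF i q(2) pu, symmetric] pr2_prod_map[OF u i] ident_comp[OF q(1)])
qed (fact B)

text \<open>An arrow over \<open>A\<close> pulls back along \<open>u\<close> to an arrow over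
  \<open>A'\<close>. The witness has first component \<open>Pr1 C A' B\<close> and second component
  obtained by applying \<open>u\<close> to the base, then \<open>h\<close>, then the projection to
  \<open>D\<close>. It makes reindexing monotone in the existential completion.\<close>

lemma vertical_base_change:
  assumes u: "u \<in> hom C A' A" and h: "h \<in> hom C (Prod C A B) (Prod C A D)"
    and vert: "Comp C (Pr1 C A D) h = Pr1 C A B"
    and B: "B \<in> Obj C" and D: "D \<in> Obj C"
  obtains h' where "h' \<in> hom C (Prod C A' B) (Prod C A' D)"
    and "Comp C (Pr1 C A' D) h' = Pr1 C A' B"
    and "Comp C (prod_map C u (Ident C D)) h' = Comp C h (prod_map C u (Ident C B))"
proof -
  have A: "A \<in> Obj C" "A' \<in> Obj C" using u hom_obj by blast+
  note iB = ident_hom[OF B] and iD = ident_hom[OF D]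
  let ?uB = "prod_map C u (Ident C B)" and ?uD = "prod_map C u (Ident C D)"
  note uB = prod_map_hom[OF u iB] and uD = prod_map_hom[OF u iD]
  note q = pr2_hom[OF A(1) D] and p = pr1_hom[OF A(2) B]
  have g: "Comp C (Pr2 C A D) (Comp C h ?uB) \<in> hom C (Prod C A' B) D"
    by (rule comp_hom[OF q comp_hom[OF h uB]])
  from pairing_ex1[OF p g] obtain h' where h': "h' \<in> hom C (Prod C A' B) (Prod C A' D)"
    and 1: "Comp C (Pr1 C A' D) h' = Pr1 C A' B"
    and 2: "Comp C (Pr2 C A' D) h' = Comp C (Pr2 C A D) (Comp C h ?uB)" by blast
  have "Comp C ?uD h' = Comp C h ?uB"
  proof (rule prod_eqI[OF comp_hom[OF uD h'] comp_hom[OF h uB] A(1) D])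
    show "Comp C (Pr1 C A D) (Comp C ?uD h') = Comp C (Pr1 C A D) (Comp C h ?uB)"
      by (simp add: comp_assoc[OF pr1_hom[OF A(1) D] uD h'] pr1_prod_map[OF u iD]
          comp_assoc[OF u pr1_hom[OF A(2) D] h', symmetric] 1
          comp_assoc[OF pr1_hom[OF A(1) D] h uB] vert pr1_prod_map[OF u iB])
    show "Comp C (Pr2 C A D) (Comp C ?uD h') = Comp C (Pr2 C A D) (Comp C h ?uB)"
      by (simp add: comp_assoc[OF q uD h'] pr2_prod_map[OF u iD]
          comp_assoc[OF iD pr2_hom[OF A(2) D] h', symmetric] 2 ident_comp[OF g])
  qed
  with h' 1 show thesis by (rule that)
qed

end

text \<open>Antisymmetry is dropped, but functoriality stays a strict equality. Reindexing by
  precomposition satisfies this on representatives, before any quotient is taken.\<close>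

locale preordered_doctrine = product_category C
  for C :: "('o, 'm, 'x) prod_category_scheme" +
  fixes P :: "('o, 'm, 'f) indexed_preorder"
  assumes le_fib: "A \<in> Obj C \<Longrightarrow> (a, b) \<in> le P A \<Longrightarrow> a \<in> fib P A \<and> b \<in> fib P A"
    and le_refl: "A \<in> Obj C \<Longrightarrow> a \<in> fib P A \<Longrightarrow> (a, a) \<in> le P A"
    and le_trans: "A \<in> Obj C \<Longrightarrow> (a, b) \<in> le P A \<Longrightarrow> (b, c) \<in> le P A \<Longrightarrow> (a, c) \<in> le P A"
    and rdx_fib: "u \<in> hom C A B \<Longrightarrow> b \<in> fib P B \<Longrightarrow> rdx P u b \<in> fib P A"
    and rdx_mono: "u \<in> hom C A B \<Longrightarrow> (b, c) \<in> le P B \<Longrightarrow> (rdx P u b, rdx P u c) \<in> le P A"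
    and rdx_ident: "A \<in> Obj C \<Longrightarrow> a \<in> fib P A \<Longrightarrow> rdx P (Ident C A) a = a"
    and rdx_comp: "u \<in> hom C A B \<Longrightarrow> v \<in> hom C B D \<Longrightarrow> d \<in> fib P D \<Longrightarrow>
      rdx P (Comp C v u) d = rdx P u (rdx P v d)"

text \<open>Lets the completion be applied to a doctrine that is itself a poset reflection.\<close>

lemma is_doctrine_preordered:
  assumes "is_doctrine C P"
  shows "preordered_doctrine C P"
proof -
  have *: "partial_order_on (fib P A) (le P A)" if "A \<in> Obj C" for A
    using assms that by (simp add: is_doctrine_def)
  show ?thesis
  proof
    show "has_finite_products C" using assms by (simp add: is_doctrine_def)
    fix A a b assume "A \<in> Obj C" "(a, b) \<in> le P A"
    then show "a \<in> fib P A \<and> b \<in> fib P A"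
      using *[of A] by (auto simp: partial_order_on_def preorder_on_def refl_on_def)
  next
    fix A a assume "A \<in> Obj C" "a \<in> fib P A"
    then show "(a, a) \<in> le P A"
      using *[of A] by (auto simp: partial_order_on_def preorder_on_def refl_on_def)
  next
    fix A a b c assume "A \<in> Obj C" "(a, b) \<in> le P A" "(b, c) \<in> le P A"
    then show "(a, c) \<in> le P A"
      using *[of A] by (auto simp: partial_order_on_def preorder_on_def dest: transD)
  qed (use assms in \<open>auto simp: is_doctrine_def hom_def; blast\<close>)+
qed

context preordered_doctrine
begin

section \<open>Poset reflection computed on representatives\<close>

lemma equiv_fib: "A \<in> Obj C \<Longrightarrow> equiv (fib P A) (equiv_of P A)"
  unfolding equiv_of_def
  by (rule equivI) (auto simp: refl_on_def sym_def trans_def dest: le_fib le_trans intro: le_refl)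

lemma class_eq_iff:
  "A \<in> Obj C \<Longrightarrow> a \<in> fib P A \<Longrightarrow> b \<in> fib P A \<Longrightarrow>
   equiv_of P A `` {a} = equiv_of P A `` {b} \<longleftrightarrow> (a, b) \<in> le P A \<and> (b, a) \<in> le P A"
  by (subst eq_equiv_class_iff[OF equiv_fib]) (auto simp: equiv_of_def)

text \<open>The order on classes asks for some comparable representatives \<open>a'\<close> and
  \<open>b'\<close>. Transitivity along a, a', b', b moves the comparison to the given ones.\<close>

lemma class_le_iff:
  assumes "A \<in> Obj C" "a \<in> fib P A" "b \<in> fib P A"
  shows "(equiv_of P A `` {a}, equiv_of P A `` {b}) \<in> le (poset_reflection C P) A \<longleftrightarrow>
         (a, b) \<in> le P A"
proof
  assume "(equiv_of P A `` {a}, equiv_of P A `` {b}) \<in> le (poset_reflection C P) A"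
  then obtain a' b' where "(a, a') \<in> le P A" "(a', b') \<in> le P A" "(b', b) \<in> le P A"
    by (auto simp: poset_reflection_def equiv_of_def)
  then show "(a, b) \<in> le P A" using le_trans[OF assms(1)] by blast
next
  assume "(a, b) \<in> le P A"
  moreover have "a \<in> equiv_of P A `` {a}" "b \<in> equiv_of P A `` {b}"
    using assms by (auto simp: equiv_of_def le_refl)
  ultimately show "(equiv_of P A `` {a}, equiv_of P A `` {b}) \<in> le (poset_reflection C P) A"
    using assms by (auto simp: poset_reflection_def quotientI)
qed

lemma class_fib: "a \<in> fib P A \<Longrightarrow> equiv_of P A `` {a} \<in> fib (poset_reflection C P) A"
  by (simp add: poset_reflection_def quotientI)

lemma fib_classE:
  assumes "c \<in> fib (poset_reflection C P) A"
  obtains a where "a \<in> fib P A" "c = equiv_of P A `` {a}"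
  using assms by (auto simp: poset_reflection_def elim: quotientE)

text \<open>The reflection saturates the image of a whole class. By monotonicity all these images
  are equivalent, so the saturation is one class, that of \<open>rdx P u b\<close>.\<close>

lemma rdx_class:
  assumes u: "u \<in> hom C A B" and b: "b \<in> fib P B"
  shows "rdx (poset_reflection C P) u (equiv_of P B `` {b}) = equiv_of P A `` {rdx P u b}"
proof -
  have obj: "A \<in> Obj C" "B \<in> Obj C" using hom_obj[OF u] by auto
  have "Dom C u = A" using u by (simp add: hom_def)
  moreover have "(rdx P u b, rdx P u b') \<in> equiv_of P A" if "(b, b') \<in> equiv_of P B" for b'
    using that rdx_mono[OF u] by (auto simp: equiv_of_def)
  moreover have "(b, b) \<in> equiv_of P B" using le_refl[OF obj(2) b] by (simp add: equiv_of_def)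
  moreover note equiv_fib[OF obj(1)]
  ultimately show ?thesis
    by (auto simp: poset_reflection_def equiv_def dest: transD)
qed

theorem poset_reflection_doctrine: "is_doctrine C (poset_reflection C P)"
  unfolding is_doctrine_def
proof (intro conjI ballI impI)
  let ?R = "poset_reflection C P"
  show "has_finite_products C" by (rule has_products)
  show "partial_order_on (fib ?R A) (le ?R A)" if A: "A \<in> Obj C" for A
    unfolding partial_order_on_def preorder_on_def
  proof (intro conjI)
    show sub: "le ?R A \<subseteq> fib ?R A \<times> fib ?R A" by (auto simp: poset_reflection_def)
    show "refl_on (fib ?R A) (le ?R A)"
      using A by (auto simp: refl_on_def class_le_iff le_refl elim!: fib_classE)
    show "trans (le ?R A)"
    proof (rule transI)
      fix x y z assume "(x, y) \<in> le ?R A" "(y, z) \<in> le ?R A"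
      moreover from this have "x \<in> fib ?R A" "y \<in> fib ?R A" "z \<in> fib ?R A" using sub by auto
      ultimately show "(x, z) \<in> le ?R A"
        by (elim fib_classE) (simp add: A class_le_iff, rule le_trans[OF A])
    qed
    show "antisym (le ?R A)"
    proof (rule antisymI)
      fix x y assume "(x, y) \<in> le ?R A" "(y, x) \<in> le ?R A"
      moreover from this have "x \<in> fib ?R A" "y \<in> fib ?R A" using sub by auto
      ultimately show "x = y"
        using A by (elim fib_classE) (simp add: class_le_iff class_eq_iff)
    qed
  qed
  show "rdx ?R u a \<in> fib ?R (Dom C u)" if "u \<in> Arr C" "a \<in> fib ?R (Cod C u)" for u a
  proof -
    have "u \<in> hom C (Dom C u) (Cod C u)" using that by (simp add: hom_def)
    with that(2) show ?thesis
      by (elim fib_classE) (simp add: rdx_class class_fib rdx_fib)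
  qed
  show "case x of (a, b) \<Rightarrow> (rdx ?R u a, rdx ?R u b) \<in> le ?R (Dom C u)"
    if "u \<in> Arr C" "x \<in> le ?R (Cod C u)" for u x
  proof -
    have u: "u \<in> hom C (Dom C u) (Cod C u)" using that by (simp add: hom_def)
    obtain a b where x: "x = (a, b)" by (cases x)
    have "a \<in> fib ?R (Cod C u)" "b \<in> fib ?R (Cod C u)"
      using that(2) x by (auto simp: poset_reflection_def)
    with that(2) u hom_obj[OF u] show ?thesis
      by (elim fib_classE) (simp add: x rdx_class class_le_iff rdx_fib rdx_mono)
  qed
  show "rdx ?R (Ident C A) a = a" if "A \<in> Obj C" "a \<in> fib ?R A" for A a
    using that by (elim fib_classE) (simp add: rdx_class[OF ident_hom] rdx_ident)
  show "rdx ?R (Comp C v u) a = rdx ?R u (rdx ?R v a)"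
    if "u \<in> Arr C" "v \<in> Arr C" "Cod C u = Dom C v" "a \<in> fib ?R (Cod C v)" for u v a
  proof -
    have u: "u \<in> hom C (Dom C u) (Dom C v)" and v: "v \<in> hom C (Dom C v) (Cod C v)"
      using that by (simp_all add: hom_def)
    from that(4) show ?thesis
      by (elim fib_classE) (simp add: rdx_class[OF comp_hom[OF v u]] rdx_class[OF u]
          rdx_class[OF v] rdx_comp[OF u v] rdx_fib[OF v])
  qed
qed

text \<open>Each order law is a construction on the witnessing vertical arrow: the identity for
  reflexivity, the composite for transitivity, base change for monotonicity. The functor laws are
  strict because reindexing leaves \<open>B\<close> fixed and \<open>prod_map\<close> with an
  identity is functorial.\<close>

theorem ex_preorder_preordered: "preordered_doctrine C (ex_preorder C P)"
proof
  let ?E = "ex_preorder C P"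
  show "a \<in> fib ?E A \<and> b \<in> fib ?E A" if "(a, b) \<in> le ?E A" for A a b
    using that by (auto simp: ex_preorder_def)
  show "(a, a) \<in> le ?E A" if A: "A \<in> Obj C" and a: "a \<in> fib ?E A" for A a
  proof -
    obtain B \<alpha> where a: "a = (B, \<alpha>)" "B \<in> Obj C" "\<alpha> \<in> fib P (Prod C A B)"
      using a by (cases a) (simp add: ex_preorder_def ex_elements_def)
    have "(\<alpha>, rdx P (Ident C (Prod C A B)) \<alpha>) \<in> le P (Prod C A B)"
      using a A by (simp add: rdx_ident le_refl prod_obj)
    with a A show ?thesis
      by (auto simp: ex_preorder_def ex_elements_def
          intro!: bexI[OF _ ident_hom] comp_ident[OF pr1_hom] prod_obj)
  qed
  show "(a, c) \<in> le ?E A"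
    if A: "A \<in> Obj C" and ab: "(a, b) \<in> le ?E A" and bc: "(b, c) \<in> le ?E A" for A a b c
  proof -
    obtain B \<alpha> D \<beta> E \<gamma> where abc: "a = (B, \<alpha>)" "b = (D, \<beta>)" "c = (E, \<gamma>)"
      by (metis surj_pair)
    obtain h where h: "h \<in> hom C (Prod C A B) (Prod C A D)"
      "Comp C (Pr1 C A D) h = Pr1 C A B" "(\<alpha>, rdx P h \<beta>) \<in> le P (Prod C A B)"
      using ab by (auto simp: ex_preorder_def abc)
    obtain g where g: "g \<in> hom C (Prod C A D) (Prod C A E)"
      "Comp C (Pr1 C A E) g = Pr1 C A D" "(\<beta>, rdx P g \<gamma>) \<in> le P (Prod C A D)"
      using bc by (auto simp: ex_preorder_def abc)
    have el: "(B, \<alpha>) \<in> ex_elements C P A" "(E, \<gamma>) \<in> ex_elements C P A"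
      using ab bc by (auto simp: ex_preorder_def abc)
    then have obj: "B \<in> Obj C" "E \<in> Obj C" and \<gamma>: "\<gamma> \<in> fib P (Prod C A E)"
      by (auto simp: ex_elements_def)
    have "Comp C (Pr1 C A E) (Comp C g h) = Pr1 C A B"
      using comp_assoc[OF pr1_hom[OF A obj(2)] g(1) h(1)] g h by simp
    moreover have "(\<alpha>, rdx P (Comp C g h) \<gamma>) \<in> le P (Prod C A B)"
      using le_trans[OF prod_obj[OF A obj(1)] h(3) rdx_mono[OF h(1) g(3)]]
      by (simp add: rdx_comp[OF h(1) g(1) \<gamma>])
    ultimately show ?thesis
      using el comp_hom[OF g(1) h(1)] by (auto simp: ex_preorder_def abc)
  qed
  show "rdx ?E u b \<in> fib ?E A" if "u \<in> hom C A B" "b \<in> fib ?E B" for u A B b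
    using that by (auto simp: ex_preorder_def ex_elements_def
        intro: rdx_fib[OF prod_map_hom[OF _ ident_hom]])
  show "(rdx ?E u b, rdx ?E u c) \<in> le ?E A"
    if u: "u \<in> hom C A B" and bc: "(b, c) \<in> le ?E B" for u A B b c
  proof -
    obtain Y \<beta> Z \<gamma> where eq: "b = (Y, \<beta>)" "c = (Z, \<gamma>)" by (metis surj_pair)
    obtain h where h: "h \<in> hom C (Prod C B Y) (Prod C B Z)"
      "Comp C (Pr1 C B Z) h = Pr1 C B Y" "(\<beta>, rdx P h \<gamma>) \<in> le P (Prod C B Y)"
      using bc by (auto simp: ex_preorder_def eq)
    have Y: "Y \<in> Obj C" and Z: "Z \<in> Obj C"
      and \<beta>: "\<beta> \<in> fib P (Prod C B Y)" and \<gamma>: "\<gamma> \<in> fib P (Prod C B Z)"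
      using bc by (auto simp: ex_preorder_def ex_elements_def eq)
    from vertical_base_change[OF u h(1,2) Y Z] obtain h'
      where h': "h' \<in> hom C (Prod C A Y) (Prod C A Z)" "Comp C (Pr1 C A Z) h' = Pr1 C A Y"
        "Comp C (prod_map C u (Ident C Z)) h' = Comp C h (prod_map C u (Ident C Y))"
      by metis
    let ?uY = "prod_map C u (Ident C Y)" and ?uZ = "prod_map C u (Ident C Z)"
    note uY = prod_map_hom[OF u ident_hom[OF Y]] and uZ = prod_map_hom[OF u ident_hom[OF Z]]
    \<comment> \<open>The inequality for \<open>h\<close> is reindexed along \<open>?uY\<close>; the
      commuting square then trades \<open>h\<close> after \<open>?uY\<close> for \<open>?uZ\<close>
      after \<open>h'\<close>.\<close>
    have "(rdx P ?uY \<beta>, rdx P h' (rdx P ?uZ \<gamma>)) \<in> le P (Prod C A Y)"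
      using rdx_mono[OF uY h(3)] rdx_comp[OF uY h(1) \<gamma>] rdx_comp[OF h'(1) uZ \<gamma>] h'(3) by simp
    with h' rdx_fib[OF uY \<beta>] rdx_fib[OF uZ \<gamma>] Y Z show ?thesis
      by (auto simp: ex_preorder_def ex_elements_def eq)
  qed
  show "rdx ?E (Ident C A) a = a" if "A \<in> Obj C" "a \<in> fib ?E A" for A a
    using that by (auto simp: ex_preorder_def ex_elements_def prod_map_ident rdx_ident prod_obj)
  show "rdx ?E (Comp C v u) d = rdx ?E u (rdx ?E v d)"
    if u: "u \<in> hom C A B" and v: "v \<in> hom C B D" and "d \<in> fib ?E D" for u v A B D d
    using that by (auto simp: ex_preorder_def ex_elements_def prod_map_comp[OF u v]
        rdx_comp[OF prod_map_hom[OF u ident_hom] prod_map_hom[OF v ident_hom]])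
qed

text \<open>Only strict functoriality is assumed of \<open>Q\<close>. Its reflexivity, transitivity
  and monotonicity are pulled back along \<phi>, which preserves and reflects the order. Reflection
  of the order also gives injectivity on classes, and surjectivity of \<phi> gives
  surjectivity.\<close>

theorem isomorphic_poset_reflections:
  fixes Q :: "('o, 'm, 'g) indexed_preorder" and \<phi> :: "'o \<Rightarrow> 'g \<Rightarrow> 'f"
  assumes le_fib_Q: "\<And>A a b. A \<in> Obj C \<Longrightarrow> (a, b) \<in> le Q A \<Longrightarrow> a \<in> fib Q A \<and> b \<in> fib Q A"
    and rdx_fib_Q: "\<And>u A B b. u \<in> hom C A B \<Longrightarrow> b \<in> fib Q B \<Longrightarrow> rdx Q u b \<in> fib Q A"
    and rdx_ident_Q: "\<And>A a. A \<in> Obj C \<Longrightarrow> a \<in> fib Q A \<Longrightarrow> rdx Q (Ident C A) a = a"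
    and rdx_comp_Q: "\<And>u v A B D d. u \<in> hom C A B \<Longrightarrow> v \<in> hom C B D \<Longrightarrow> d \<in> fib Q D \<Longrightarrow>
      rdx Q (Comp C v u) d = rdx Q u (rdx Q v d)"
    and \<phi>_fib: "\<And>A a. A \<in> Obj C \<Longrightarrow> a \<in> fib Q A \<Longrightarrow> \<phi> A a \<in> fib P A"
    and \<phi>_le: "\<And>A a b. A \<in> Obj C \<Longrightarrow> a \<in> fib Q A \<Longrightarrow> b \<in> fib Q A \<Longrightarrow>
      (a, b) \<in> le Q A \<longleftrightarrow> (\<phi> A a, \<phi> A b) \<in> le P A"
    and \<phi>_surj: "\<And>A c. A \<in> Obj C \<Longrightarrow> c \<in> fib P A \<Longrightarrow> \<exists>a\<in>fib Q A. \<phi> A a = c"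
    and \<phi>_nat: "\<And>u A B b. u \<in> hom C A B \<Longrightarrow> b \<in> fib Q B \<Longrightarrow> \<phi> A (rdx Q u b) = rdx P u (\<phi> B b)"
  shows "isomorphic_doctrines C (poset_reflection C Q) (poset_reflection C P)"
proof -
  interpret Q: preordered_doctrine C Q
  proof
    show "(a, c) \<in> le Q A" if "A \<in> Obj C" "(a, b) \<in> le Q A" "(b, c) \<in> le Q A" for A a b c
      using that le_fib_Q[OF that(1,2)] le_fib_Q[OF that(1,3)] \<phi>_le le_trans[OF that(1)] by metis
    show "(rdx Q u b, rdx Q u c) \<in> le Q A" if "u \<in> hom C A B" "(b, c) \<in> le Q B" for u A B b c
    proof -
      have "A \<in> Obj C" "B \<in> Obj C" using hom_obj[OF that(1)] by auto
      then show ?thesis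
        using that le_fib_Q[of B b c] by (simp add: \<phi>_le rdx_fib_Q \<phi>_nat rdx_mono)
    qed
    show "(a, a) \<in> le Q A" if "A \<in> Obj C" "a \<in> fib Q A" for A a
      using that by (simp add: \<phi>_le \<phi>_fib le_refl)
  qed (fact le_fib_Q rdx_fib_Q rdx_ident_Q rdx_comp_Q)+
  \<comment> \<open>Saturating the image avoids choosing a representative;
    \<open>\<theta>_class\<close> then shows that the result is the class of the image of any
    representative.\<close>
  define \<theta> where "\<theta> A c = equiv_of P A `` (\<phi> A ` c)" for A c
  have \<theta>_class: "\<theta> A (equiv_of Q A `` {a}) = equiv_of P A `` {\<phi> A a}"
    if A: "A \<in> Obj C" and a: "a \<in> fib Q A" for A a
  proof -
    have "(\<phi> A a, \<phi> A b) \<in> equiv_of P A" if "(a, b) \<in> equiv_of Q A" for b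
      using that A Q.le_fib[OF A, of a b] by (auto simp: equiv_of_def \<phi>_le)
    moreover have "(a, a) \<in> equiv_of Q A" using Q.le_refl[OF A a] by (simp add: equiv_of_def)
    ultimately show ?thesis
      using equiv_fib[OF A] by (auto simp: \<theta>_def equiv_def dest: transD)
  qed
  show ?thesis
    unfolding isomorphic_doctrines_def
  proof (intro conjI exI[of _ \<theta>] ballI)
    show "is_doctrine C (poset_reflection C Q)" by (rule Q.poset_reflection_doctrine)
    show "is_doctrine C (poset_reflection C P)" by (rule poset_reflection_doctrine)
    fix A assume A: "A \<in> Obj C"
    show "bij_betw (\<theta> A) (fib (poset_reflection C Q) A) (fib (poset_reflection C P) A)"
      unfolding bij_betw_def
    proof
      show "inj_on (\<theta> A) (fib (poset_reflection C Q) A)"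
        by (intro inj_onI, elim Q.fib_classE)
          (simp add: A \<theta>_class class_eq_iff Q.class_eq_iff \<phi>_fib \<phi>_le)
      show "\<theta> A ` fib (poset_reflection C Q) A = fib (poset_reflection C P) A"
      proof
        show "\<theta> A ` fib (poset_reflection C Q) A \<subseteq> fib (poset_reflection C P) A"
          using A by (auto simp: \<theta>_class \<phi>_fib class_fib elim!: Q.fib_classE)
        show "fib (poset_reflection C P) A \<subseteq> \<theta> A ` fib (poset_reflection C Q) A"
        proof
          fix c assume "c \<in> fib (poset_reflection C P) A"
          then obtain p where "p \<in> fib P A" "c = equiv_of P A `` {p}" by (rule fib_classE)
          with \<phi>_surj[OF A] obtain q where "q \<in> fib Q A" "c = equiv_of P A `` {\<phi> A q}" by blast
          then show "c \<in> \<theta> A ` fib (poset_reflection C Q) A"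
            using \<theta>_class[OF A] Q.class_fib by blast
        qed
      qed
    qed
    fix a b assume "a \<in> fib (poset_reflection C Q) A" "b \<in> fib (poset_reflection C Q) A"
    then show "(a, b) \<in> le (poset_reflection C Q) A \<longleftrightarrow>
        (\<theta> A a, \<theta> A b) \<in> le (poset_reflection C P) A"
      by (elim Q.fib_classE) (simp add: A \<theta>_class class_le_iff Q.class_le_iff \<phi>_fib \<phi>_le)
  next
    fix u a assume "u \<in> Arr C" and a: "a \<in> fib (poset_reflection C Q) (Cod C u)"
    then have u: "u \<in> hom C (Dom C u) (Cod C u)" by (simp add: hom_def)
    with a hom_obj[OF u]
    show "\<theta> (Dom C u) (rdx (poset_reflection C Q) u a) =
          rdx (poset_reflection C P) u (\<theta> (Cod C u) a)"
      by (elim Q.fib_classE) (simp add: Q.rdx_class rdx_class \<theta>_class rdx_fib_Q \<phi>_fib \<phi>_nat)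
  qed
qed

end

section \<open>Subsets of a PCA and computable functions\<close>

locale elementary_pca =
  fixes app :: "'a \<Rightarrow> 'a \<Rightarrow> 'a option" and A' :: "'a set" and pr p1 p2 :: 'a
  assumes sub_pca: "elementary_sub_pca app A'"
    and pairing: "pairing_elements app A' pr p1 p2"
begin

abbreviation M :: "('a set, 'a arrow) prod_category" where
  "M \<equiv> Mod_p app A' pr p1 p2"

abbreviation pair :: "'a \<Rightarrow> 'a \<Rightarrow> 'a" where
  "pair \<equiv> tuple app pr"

abbreviation times :: "'a set \<Rightarrow> 'a set \<Rightarrow> 'a set" where
  "times \<equiv> pca_prod app pr"

abbreviation pfst :: "'a \<Rightarrow> 'a" where
  "pfst z \<equiv> the (app p1 z)"

abbreviation psnd :: "'a \<Rightarrow> 'a" where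
  "psnd z \<equiv> the (app p2 z)"

text \<open>Forgets the codomain and the extensionality built into \<open>computable_funs\<close>,
  so that closure properties can be stated for bare lambda terms.\<close>

definition computable_on :: "'a set \<Rightarrow> ('a \<Rightarrow> 'a) \<Rightarrow> bool" where
  "computable_on X f \<longleftrightarrow> (\<exists>a\<in>A'. \<forall>x\<in>X. app a x = Some (f x))"

section \<open>Realizers for constants, identity, composition and pairing\<close>

lemma closed: "a \<in> A' \<Longrightarrow> b \<in> A' \<Longrightarrow> app a b = Some c \<Longrightarrow> c \<in> A'"
  using sub_pca unfolding elementary_sub_pca_def by blast

lemma ex_K:
  obtains k where "k \<in> A'" "\<And>a. \<exists>c. app k a = Some c \<and> (\<forall>b. app c b = Some a)"
proof -
  obtain k s where k: "k \<in> A'" and ks: "ks_combinators app k s"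
    using sub_pca unfolding elementary_sub_pca_def by blast
  have "\<exists>c. app k a = Some c \<and> (\<forall>b. app c b = Some a)" for a
  proof -
    have *: "app k a \<noteq> None" "oapp app (app k a) (Some b) \<simeq> Some a" for b
      using ks unfolding ks_combinators_def by blast+
    then show ?thesis by (auto simp: kleene_eq_def oapp_def)
  qed
  with k show thesis by (rule that)
qed

lemma ex_const:
  assumes "a \<in> A'"
  shows "\<exists>c\<in>A'. \<forall>x. app c x = Some a"
proof -
  obtain k where k: "k \<in> A'" "\<And>a. \<exists>c. app k a = Some c \<and> (\<forall>b. app c b = Some a)"
    using ex_K by blast
  then show ?thesis using closed[OF k(1) assms] by blast
qed

text \<open>The witness is \<open>s a b\<close>, which lies in \<open>A'\<close> by closure. The
  one-sided \<open>\<simeq>\<close> determines its value at \<open>x\<close> only where the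
  right-hand side is defined, hence the premises naming \<open>d\<close>, \<open>e\<close> and
  \<open>r\<close>.\<close>

lemma ex_S:
  assumes a: "a \<in> A'" and b: "b \<in> A'"
  shows "\<exists>c\<in>A'. \<forall>x d e r. app a x = Some d \<longrightarrow> app b x = Some e \<longrightarrow> app d e = Some r \<longrightarrow>
    app c x = Some r"
proof -
  obtain k s where s: "s \<in> A'" and ks: "ks_combinators app k s"
    using sub_pca unfolding elementary_sub_pca_def by blast
  have def: "app s a \<noteq> None" "oapp app (app s a) (Some b) \<noteq> None"
    using ks unfolding ks_combinators_def by blast+
  from def(1) obtain d where d: "app s a = Some d" by blast
  with def(2) obtain c where c: "app d b = Some c" by (auto simp: oapp_def)
  from d c have "c \<in> A'" using closed[OF s a] closed[OF _ b] by blast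
  moreover have "oapp app (Some c) (Some x) \<simeq> oapp app (app a x) (app b x)" for x
  proof -
    have "oapp app (oapp app (app s a) (Some b)) (Some x) \<simeq> oapp app (app a x) (app b x)"
      using ks unfolding ks_combinators_def by blast
    then show ?thesis using c d by (simp add: oapp_def)
  qed
  ultimately show ?thesis by (intro bexI[of _ c]) (auto simp: oapp_def kleene_eq_def)
qed

lemma computable_const: "a \<in> A' \<Longrightarrow> computable_on X (\<lambda>_. a)"
  unfolding computable_on_def using ex_const by blast

lemma computable_id: "computable_on X (\<lambda>x. x)"
proof -
  obtain k where k: "k \<in> A'" "\<And>a. \<exists>c. app k a = Some c \<and> (\<forall>b. app c b = Some a)"
    using ex_K by blast
  \<comment> \<open>The identity as \<open>s k k\<close>: applying \<open>k x\<close> to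
    \<open>k x\<close> returns \<open>x\<close>.\<close>
  obtain i where "i \<in> A'" and i: "\<And>x d e r. app k x = Some d \<Longrightarrow> app k x = Some e \<Longrightarrow>
    app d e = Some r \<Longrightarrow> app i x = Some r"
    using ex_S[OF k(1) k(1)] by blast
  moreover have "app i x = Some x" for x
    using k(2)[of x] i[of x] by blast
  ultimately show ?thesis unfolding computable_on_def by blast
qed

text \<open>The realizer is \<open>s (k b) a\<close>, where \<open>c\<close> in the proof plays
  \<open>k b\<close>: it sends \<open>x\<close> to \<open>b\<close> applied to
  \<open>a x\<close>.\<close>

lemma computable_comp:
  assumes f: "computable_on X f" and g: "computable_on Y g" and fX: "\<And>x. x \<in> X \<Longrightarrow> f x \<in> Y"
  shows "computable_on X (\<lambda>x. g (f x))"
proof -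
  obtain a b where a: "a \<in> A'" "\<And>x. x \<in> X \<Longrightarrow> app a x = Some (f x)"
    and b: "b \<in> A'" "\<And>y. y \<in> Y \<Longrightarrow> app b y = Some (g y)"
    using f g by (auto simp: computable_on_def)
  obtain c where c: "c \<in> A'" "\<And>x. app c x = Some b" using ex_const[OF b(1)] by blast
  from ex_S[OF c(1) a(1)] obtain e where "e \<in> A'"
    "\<And>x y r. app a x = Some y \<Longrightarrow> app b y = Some r \<Longrightarrow> app e x = Some r"
    using c(2) by blast
  then show ?thesis using a b fX unfolding computable_on_def by blast
qed

text \<open>The projection equations assert equality with a defined value, which forces
  \<open>pr a b\<close> itself to be defined; so the \<open>the\<close> in \<open>tuple\<close>
  always returns the actual value.\<close>

lemma pair_defined: "\<exists>d. app pr a = Some d \<and> app d b = Some (pair a b)"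
  and app_p1_pair [simp]: "app p1 (pair a b) = Some a"
  and app_p2_pair [simp]: "app p2 (pair a b) = Some b"
proof -
  have 1: "oapp app (Some p1) (oapp app (app pr a) (Some b)) = Some a"
    and 2: "oapp app (Some p2) (oapp app (app pr a) (Some b)) = Some b"
    using pairing by (auto simp: pairing_elements_def)
  from 1 obtain d e where d: "app pr a = Some d" "app d b = Some e"
    by (auto simp: oapp_def bind_eq_Some_conv)
  then have e: "e = pair a b" by (simp add: tuple_def oapp_def)
  show "\<exists>d. app pr a = Some d \<and> app d b = Some (pair a b)" using d e by blast
  show "app p1 (pair a b) = Some a" using 1 d e by (simp add: oapp_def)
  show "app p2 (pair a b) = Some b" using 2 d e by (simp add: oapp_def)
qed

lemma pair_eq_iff [simp]: "pair a b = pair c d \<longleftrightarrow> a = c \<and> b = d"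
  by (metis app_p1_pair app_p2_pair option.inject)

lemma pair_in_times [simp]: "pair x y \<in> times X Y \<longleftrightarrow> x \<in> X \<and> y \<in> Y"
  by (auto simp: pca_prod_def)

lemma timesE [elim!]:
  assumes "z \<in> times X Y"
  obtains x y where "z = pair x y" "x \<in> X" "y \<in> Y"
  using assms by (auto simp: pca_prod_def)

text \<open>The realizer is \<open>s (s (k pr) a) b\<close>, built in two applications of
  \<open>ex_S\<close>.\<close>

lemma computable_pair:
  assumes "computable_on X f" "computable_on X g"
  shows "computable_on X (\<lambda>x. pair (f x) (g x))"
proof -
  obtain a b where a: "a \<in> A'" "\<And>x. x \<in> X \<Longrightarrow> app a x = Some (f x)"
    and b: "b \<in> A'" "\<And>x. x \<in> X \<Longrightarrow> app b x = Some (g x)"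
    using assms by (auto simp: computable_on_def)
  have "pr \<in> A'" using pairing by (simp add: pairing_elements_def)
  then obtain c where c: "c \<in> A'" "\<And>x. app c x = Some pr" using ex_const by blast
  from ex_S[OF c(1) a(1)] obtain d where d: "d \<in> A'"
    "\<And>x y r. app a x = Some y \<Longrightarrow> app pr y = Some r \<Longrightarrow> app d x = Some r"
    using c(2) by blast
  from ex_S[OF d(1) b(1)] obtain e where e: "e \<in> A'"
    "\<And>x y z r. app d x = Some y \<Longrightarrow> app b x = Some z \<Longrightarrow> app y z = Some r \<Longrightarrow> app e x = Some r"
    by blast
  have "app e x = Some (pair (f x) (g x))" if "x \<in> X" for x
    using pair_defined[of "f x" "g x"] a(2)[OF that] b(2)[OF that] d(2) e(2) by metis
  with e(1) show ?thesis unfolding computable_on_def by blast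
qed

lemma computable_pfst: "computable_on (times X Y) pfst"
  and computable_psnd: "computable_on (times X Y) psnd"
proof -
  have "p1 \<in> A'" "p2 \<in> A'" using pairing by (simp_all add: pairing_elements_def)
  then show "computable_on (times X Y) pfst" "computable_on (times X Y) psnd"
    unfolding computable_on_def by (force intro: bexI[of _ p1], force intro: bexI[of _ p2])
qed

section \<open>Computable functions as arrows\<close>

lemma computable_cong: "(\<And>x. x \<in> X \<Longrightarrow> f x = g x) \<Longrightarrow> computable_on X f \<longleftrightarrow> computable_on X g"
  by (simp add: computable_on_def)

lemma computable_funs_iff:
  "f \<in> computable_funs app A' X Y \<longleftrightarrow> f \<in> X \<rightarrow>\<^sub>E Y \<and> computable_on X f"
  by (simp add: computable_funs_def computable_on_def)

lemma restrict_computable: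
  "(\<And>x. x \<in> X \<Longrightarrow> f x \<in> Y) \<Longrightarrow> computable_on X f \<Longrightarrow>
   restrict f X \<in> computable_funs app A' X Y"
  using computable_cong[of X "restrict f X" f] by (auto simp: computable_funs_iff)

lemma hom_iff:
  "u \<in> hom M X Y \<longleftrightarrow> (\<exists>f\<in>computable_funs app A' X Y. u = Arrow X f Y)"
  by (cases u) (auto simp: hom_def Mod_p_def)

lemma Arrow_hom [simp]: "Arrow X f Y \<in> hom M X' Y' \<longleftrightarrow>
  X' = X \<and> Y' = Y \<and> f \<in> computable_funs app A' X Y"
  by (auto simp: hom_iff)

lemma Obj_M [simp]: "X \<in> Obj M"
  by (simp add: Mod_p_def)

lemma Comp_Arrow [simp]: "Comp M (Arrow Y g Z) (Arrow X f Y') = Arrow X (compose X g f) Z"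
  by (simp add: Mod_p_def)

lemma Ident_M: "Ident M X = Arrow X (\<lambda>x\<in>X. x) X"
  and Prod_M: "Prod M X Y = times X Y"
  and Pr1_M: "Pr1 M X Y = Arrow (times X Y) (\<lambda>z\<in>times X Y. pfst z) X"
  and Pr2_M: "Pr2 M X Y = Arrow (times X Y) (\<lambda>z\<in>times X Y. psnd z) Y"
  and Dom_M: "Dom M (Arrow X f Y) = X"
  and Cod_M: "Cod M (Arrow X f Y) = Y"
  and Arr_M: "Arrow X f Y \<in> Arr M \<longleftrightarrow> f \<in> computable_funs app A' X Y"
  by (simp_all add: Mod_p_def)

lemmas Mod_p_simps = Ident_M Prod_M Pr1_M Pr2_M Dom_M Cod_M Arr_M

lemma compose_computable:
  "g \<in> computable_funs app A' Y Z \<Longrightarrow> f \<in> computable_funs app A' X Y \<Longrightarrow>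
   compose X g f \<in> computable_funs app A' X Z"
  unfolding compose_def
  by (rule restrict_computable) (auto simp: computable_funs_iff intro: computable_comp)

lemma computable_funs_ext: "f \<in> computable_funs app A' X Y \<Longrightarrow> f \<in> X \<rightarrow>\<^sub>E Y"
  by (simp add: computable_funs_iff)

lemma computable_funs_mem: "f \<in> computable_funs app A' X Y \<Longrightarrow> x \<in> X \<Longrightarrow> f x \<in> Y"
  by (auto simp: computable_funs_iff)

lemma compose_PiE: "F \<in> Y \<rightarrow>\<^sub>E S \<Longrightarrow> f \<in> computable_funs app A' X Y \<Longrightarrow> compose X F f \<in> X \<rightarrow>\<^sub>E S"
  by (auto simp: compose_def computable_funs_mem PiE_mem)

section \<open>The category \<open>Mod_p\<close> and its finite products\<close>

lemma Mod_p_category: "is_category M"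
  unfolding is_category_def
proof (intro conjI ballI impI)
  fix A show "Ident M A \<in> hom M A A"
    by (simp add: Mod_p_simps) (rule restrict_computable, auto intro: computable_id)
next
  fix f g assume "f \<in> Arr M" "g \<in> Arr M" "Cod M f = Dom M g"
  then show "Comp M g f \<in> hom M (Dom M f) (Cod M g)"
    by (cases f; cases g) (auto simp: Mod_p_simps intro: compose_computable)
next
  fix f assume "f \<in> Arr M"
  then show "Comp M f (Ident M (Dom M f)) = f" "Comp M (Ident M (Cod M f)) f = f"
    by (cases f; auto simp: Mod_p_simps compose_def dest!: computable_funs_ext
        intro!: PiE_ext[where k="src f" and s="\<lambda>_. tgt f"])+
next
  fix f g h assume "f \<in> Arr M" "g \<in> Arr M" "h \<in> Arr M" "Cod M f = Dom M g" "Cod M g = Dom M h"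
  then show "Comp M h (Comp M g f) = Comp M (Comp M h g) f"
    by (cases f; cases g; cases h)
       (auto simp: Mod_p_simps compose_def fun_eq_iff dest!: computable_funs_ext)
qed simp_all

lemma Mod_p_terminal: "\<exists>T. is_terminal M T"
proof -
  \<comment> \<open>The point is taken in \<open>A'\<close>, since the constant map to it needs a
    realizer there.\<close>
  obtain t where t: "t \<in> A'" using sub_pca unfolding elementary_sub_pca_def by blast
  have "\<exists>!u. u \<in> hom M X {t}" for X
  proof (rule ex1I)
    show "Arrow X (\<lambda>x\<in>X. t) {t} \<in> hom M X {t}"
      by (simp, rule restrict_computable) (auto intro: computable_const t)
    show "u = Arrow X (\<lambda>x\<in>X. t) {t}" if "u \<in> hom M X {t}" for u
      using that by (auto simp: hom_iff dest!: computable_funs_ext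
          intro!: PiE_ext[where k=X and s="\<lambda>_. {t}"])
  qed
  then show ?thesis unfolding is_terminal_def using Obj_M by blast
qed

text \<open>Existence comes from \<open>computable_pair\<close>. Uniqueness holds because every
  element of \<open>times X Y\<close> is a pair, hence determined by its two projections.\<close>

lemma Mod_p_product: "is_product M X Y (times X Y) (Pr1 M X Y) (Pr2 M X Y)"
  unfolding is_product_def
proof (intro conjI ballI)
  show "Pr1 M X Y \<in> hom M (times X Y) X"
    by (simp add: Mod_p_simps) (rule restrict_computable, auto intro: computable_pfst)
  show "Pr2 M X Y \<in> hom M (times X Y) Y"
    by (simp add: Mod_p_simps) (rule restrict_computable, auto intro: computable_psnd)
  fix T u v assume "u \<in> hom M T X" "v \<in> hom M T Y"
  then obtain f g where f: "f \<in> computable_funs app A' T X" "u = Arrow T f X"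
    and g: "g \<in> computable_funs app A' T Y" "v = Arrow T g Y"
    by (auto simp: hom_iff)
  then have f': "f \<in> T \<rightarrow>\<^sub>E X" "computable_on T f" and g': "g \<in> T \<rightarrow>\<^sub>E Y" "computable_on T g"
    by (auto simp: computable_funs_iff)
  show "\<exists>!m. m \<in> hom M T (times X Y) \<and> Comp M (Pr1 M X Y) m = u \<and> Comp M (Pr2 M X Y) m = v"
  proof (rule ex1I)
    let ?m = "\<lambda>t\<in>T. pair (f t) (g t)"
    have "?m \<in> computable_funs app A' T (times X Y)"
      using f' g' by (intro restrict_computable computable_pair) auto
    moreover have "compose T (\<lambda>z\<in>times X Y. pfst z) ?m = f"
      using f' g' by (intro PiE_ext[where k=T and s="\<lambda>_. X"]) (auto simp: compose_def)
    moreover have "compose T (\<lambda>z\<in>times X Y. psnd z) ?m = g"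
      using f' g' by (intro PiE_ext[where k=T and s="\<lambda>_. Y"]) (auto simp: compose_def)
    ultimately show "Arrow T ?m (times X Y) \<in> hom M T (times X Y) \<and>
      Comp M (Pr1 M X Y) (Arrow T ?m (times X Y)) = u \<and>
      Comp M (Pr2 M X Y) (Arrow T ?m (times X Y)) = v"
      by (simp add: Mod_p_simps f(2) g(2))
    fix w assume w: "w \<in> hom M T (times X Y) \<and> Comp M (Pr1 M X Y) w = u \<and> Comp M (Pr2 M X Y) w = v"
    then obtain m where m: "m \<in> T \<rightarrow>\<^sub>E times X Y" "w = Arrow T m (times X Y)"
      by (auto simp: hom_iff dest: computable_funs_ext)
    have "m t = pair (f t) (g t)" if t: "t \<in> T" for t
    proof -
      have "m t \<in> times X Y" using m(1) t by auto
      then obtain x y where xy: "m t = pair x y" "x \<in> X" "y \<in> Y" by auto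
      moreover have "compose T (\<lambda>z\<in>times X Y. pfst z) m t = f t"
        "compose T (\<lambda>z\<in>times X Y. psnd z) m t = g t"
        using w by (auto simp: Mod_p_simps f(2) g(2) m(2))
      ultimately show ?thesis using t by (simp add: compose_def)
    qed
    then have "m = ?m" using m(1) by (auto simp: fun_eq_iff)
    then show "w = Arrow T ?m (times X Y)" by (simp add: m(2))
  qed
qed simp

lemma Mod_p_finite_products: "has_finite_products M"
  using Mod_p_category Mod_p_terminal Mod_p_product
  by (auto simp: has_finite_products_def Prod_M)

sublocale product_category M
  by standard (rule Mod_p_finite_products)

text \<open>The value of the abstractly defined product arrow is recovered by evaluating both
  projection equations at \<open>pair x b\<close>.\<close>

lemma fn_prod_map:
  assumes f: "f \<in> computable_funs app A' X Y" and x: "x \<in> X" "b \<in> B"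
  shows "fn (prod_map M (Arrow X f Y) (Ident M B)) (pair x b) = pair (f x) b"
proof -
  have u: "Arrow X f Y \<in> hom M X Y" using f by simp
  note i = ident_hom[OF Obj_M, of B]
  obtain m where m: "m \<in> times X B \<rightarrow>\<^sub>E times Y B"
    "prod_map M (Arrow X f Y) (Ident M B) = Arrow (times X B) m (times Y B)"
    using prod_map_hom[OF u i] by (auto simp: hom_iff Prod_M dest: computable_funs_ext)
  have z: "pair x b \<in> times X B" using x by simp
  then have "m (pair x b) \<in> times Y B" by (rule PiE_mem[OF m(1)])
  then obtain y c where yc: "m (pair x b) = pair y c" "y \<in> Y" "c \<in> B" by auto
  have "compose (times X B) (\<lambda>z\<in>times Y B. pfst z) m (pair x b) =
        compose (times X B) f (\<lambda>z\<in>times X B. pfst z) (pair x b)"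
    using pr1_prod_map[OF u i] by (simp add: m(2) Pr1_M)
  moreover have "compose (times X B) (\<lambda>z\<in>times Y B. psnd z) m (pair x b) =
        compose (times X B) (\<lambda>x\<in>B. x) (\<lambda>z\<in>times X B. psnd z) (pair x b)"
    using pr2_prod_map[OF u i] unfolding m(2) by (simp add: Pr2_M Ident_M)
  ultimately show ?thesis using x yc m(2) by (simp add: compose_def)
qed

text \<open>A realizer of the order is uniform in the point \<open>p\<close>, so the same one serves
  after any precomposition; this is monotonicity.\<close>

lemma sW_preordered: "preordered_doctrine M (sW_preorder app A')"
proof
  let ?P = "sW_preorder app A'"
  show "a \<in> fib ?P X \<and> b \<in> fib ?P X" if "(a, b) \<in> le ?P X" for a b X
    using that by (auto simp: sW_preorder_def)
  show "(f, f) \<in> le ?P X" if "f \<in> fib ?P X" for f X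
    using that computable_id[of UNIV]
    by (fastforce simp: sW_preorder_def computable_on_def app_in_def)
  show "(f, h) \<in> le ?P X" if fg: "(f, g) \<in> le ?P X" and gh: "(g, h) \<in> le ?P X" for f g h X
  proof -
    obtain a where a: "a \<in> A'" "\<And>p q. p \<in> X \<Longrightarrow> q \<in> g p \<Longrightarrow> \<exists>r\<in>f p. app a q = Some r"
      using fg by (auto simp: sW_preorder_def app_in_def)
    obtain b where b: "b \<in> A'" "\<And>p q. p \<in> X \<Longrightarrow> q \<in> h p \<Longrightarrow> \<exists>r\<in>g p. app b q = Some r"
      using gh by (auto simp: sW_preorder_def app_in_def)
    \<comment> \<open>Realizers run against the order, from the larger predicate to the smaller, so
      \<open>b\<close> acts first and the composite is \<open>s (k a) b\<close>.\<close>
    obtain c where c: "c \<in> A'" "\<And>x. app c x = Some a" using ex_const[OF a(1)] by blast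
    from ex_S[OF c(1) b(1)] obtain e where e: "e \<in> A'"
      "\<And>x y r. app b x = Some y \<Longrightarrow> app a y = Some r \<Longrightarrow> app e x = Some r"
      using c(2) by blast
    have "\<forall>p\<in>X. \<forall>q\<in>h p. app_in app e q (f p)"
      unfolding app_in_def using a(2) b(2) e(2) by metis
    with e(1) fg gh show ?thesis by (auto simp: sW_preorder_def)
  qed
  show "rdx ?P u g \<in> fib ?P X" if "u \<in> hom M X Y" "g \<in> fib ?P Y" for u X Y g
    using that by (clarsimp simp: sW_preorder_def hom_iff) (erule (1) compose_PiE)
  show "(rdx ?P u f, rdx ?P u g) \<in> le ?P X" 
    if u: "u \<in> hom M X Y" and fg: "(f, g) \<in> le ?P Y" for u X Y f g
  proof -
    obtain k where k: "k \<in> computable_funs app A' X Y" "u = Arrow X k Y"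
      using u by (auto simp: hom_iff)
    obtain h where "h \<in> A'" "\<forall>p\<in>Y. \<forall>q\<in>g p. app_in app h q (f p)"
      and fib: "f \<in> Y \<rightarrow>\<^sub>E nonempty_sets" "g \<in> Y \<rightarrow>\<^sub>E nonempty_sets"
      using fg by (auto simp: sW_preorder_def)
    then have "\<exists>h\<in>A'. \<forall>p\<in>X. \<forall>q\<in>g (k p). app_in app h q (f (k p))"
      using computable_funs_mem[OF k(1)] by blast
    with fib show ?thesis
      by (auto simp: sW_preorder_def k(2) compose_def computable_funs_mem[OF k(1)] PiE_mem)
  qed
  show "rdx ?P (Ident M X) f = f" if "f \<in> fib ?P X" for X f
  proof
    have f: "f \<in> X \<rightarrow>\<^sub>E nonempty_sets" using that by (simp add: sW_preorder_def)
    show "rdx ?P (Ident M X) f x = f x" for x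
      by (cases "x \<in> X") (simp_all add: sW_preorder_def Ident_M compose_def PiE_arb[OF f])
  qed
  show "rdx ?P (Comp M v u) f = rdx ?P u (rdx ?P v f)"
    if "u \<in> hom M X Y" "v \<in> hom M Y Z" for u v X Y Z f
    using that by (auto simp: sW_preorder_def hom_iff compose_def fun_eq_iff computable_funs_mem)
qed

section \<open>Uncurrying generalized Weihrauch predicates\<close>

abbreviation sW :: "('a set, 'a arrow, 'a \<Rightarrow> 'a set) indexed_preorder" where
  "sW \<equiv> sW_preorder app A'"

abbreviation SW :: "('a set, 'a arrow, 'a set \<times> ('a \<Rightarrow> 'a \<Rightarrow> 'a set)) indexed_preorder" where
  "SW \<equiv> SW_preorder app A' pr"

abbreviation sWex :: "('a set, 'a arrow, 'a set \<times> ('a \<Rightarrow> 'a set) set) indexed_preorder" where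
  "sWex \<equiv> ex_preorder M (elementary_strong_Weihrauch app A' pr p1 p2)"

definition uncurry :: "'a set \<Rightarrow> 'a set \<Rightarrow> ('a \<Rightarrow> 'a \<Rightarrow> 'a set) \<Rightarrow> 'a \<Rightarrow> 'a set" where
  "uncurry X Y F = (\<lambda>z\<in>times X Y. F (pfst z) (psnd z))"

text \<open>The second component is a class because the completion is formed over the reflected
  doctrine; the set \<open>Y\<close> is kept as it is.\<close>

definition ex_class ::
    "'a set \<Rightarrow> 'a set \<times> ('a \<Rightarrow> 'a \<Rightarrow> 'a set) \<Rightarrow> 'a set \<times> ('a \<Rightarrow> 'a set) set" where
  "ex_class X = (\<lambda>(Y, F). (Y, equiv_of sW (times X Y) `` {uncurry X Y F}))"

sublocale sW: preordered_doctrine M sW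
  by (rule sW_preordered)

lemma elementary_strong_Weihrauch_preordered:
  "preordered_doctrine M (elementary_strong_Weihrauch app A' pr p1 p2)"
  unfolding elementary_strong_Weihrauch_def
  by (intro is_doctrine_preordered sW.poset_reflection_doctrine)

sublocale esW: preordered_doctrine M "elementary_strong_Weihrauch app A' pr p1 p2"
  by (rule elementary_strong_Weihrauch_preordered)

sublocale sWex: preordered_doctrine M sWex
  by (rule esW.ex_preorder_preordered)

lemma uncurry_fib:
  assumes "F \<in> X \<rightarrow>\<^sub>E (Y \<rightarrow>\<^sub>E nonempty_sets)"
  shows "uncurry X Y F \<in> fib sW (times X Y)"
proof -
  have "F x y \<in> nonempty_sets" if "x \<in> X" "y \<in> Y" for x y
    using that by (intro PiE_mem[OF PiE_mem[OF assms]])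
  then show ?thesis by (auto simp: uncurry_def sW_preorder_def)
qed

lemma ex_class_fib:
  assumes "a \<in> fib SW X"
  shows "ex_class X a \<in> fib sWex X"
proof -
  obtain Y F where a: "a = (Y, F)" "F \<in> X \<rightarrow>\<^sub>E (Y \<rightarrow>\<^sub>E nonempty_sets)"
    using assms by (cases a) (auto simp: SW_preorder_def gen_Weihrauch_preds_def)
  show ?thesis
    using sW.class_fib[OF uncurry_fib[OF a(2)]]
    by (simp add: a(1) ex_class_def ex_preorder_def ex_elements_def Prod_M
        elementary_strong_Weihrauch_def)
qed

lemma ex_class_surj:
  assumes "c \<in> fib sWex X"
  shows "\<exists>a\<in>fib SW X. ex_class X a = c"
proof -
  obtain Y \<alpha> where c: "c = (Y, \<alpha>)"
    and "\<alpha> \<in> fib (poset_reflection M sW) (times X Y)"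
    using assms
    by (cases c) (auto simp: ex_preorder_def ex_elements_def Prod_M elementary_strong_Weihrauch_def)
  then obtain f where f: "f \<in> fib sW (times X Y)" and \<alpha>: "\<alpha> = equiv_of sW (times X Y) `` {f}"
    by (elim sW.fib_classE)
  \<comment> \<open>Currying of a representative. The two restrictions place \<open>F\<close> in the
    extensional function spaces, so uncurrying returns \<open>f\<close> exactly, also outside the
    product.\<close>
  define F where "F = (\<lambda>x\<in>X. \<lambda>y\<in>Y. f (pair x y))"
  have f': "f \<in> times X Y \<rightarrow>\<^sub>E nonempty_sets" using f by (simp add: sW_preorder_def)
  have "uncurry X Y F z = f z" for z
    by (cases "z \<in> times X Y") (auto simp: uncurry_def F_def PiE_arb[OF f'])
  then have "uncurry X Y F = f" by (rule ext)
  moreover have "(Y, F) \<in> fib SW X"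
    by (auto simp: SW_preorder_def gen_Weihrauch_preds_def F_def intro!: PiE_mem[OF f'])
  ultimately show ?thesis
    by (intro bexI[of _ "(Y, F)"]) (simp_all add: ex_class_def c \<alpha>)
qed

text \<open>A vertical arrow carries no information beyond its second component: \<open>k\<close>
  yields the pairing of the first projection with \<open>k\<close>, and \<open>h\<close> yields its
  second projection. The realizer \<open>e\<close> is the same on both sides, since
  \<open>uncurry X Z G\<close> at \<open>h (pair x y)\<close> is
  \<open>G x (k (pair x y))\<close>.\<close>

lemma SW_le_iff_vertical:
  assumes F: "F \<in> X \<rightarrow>\<^sub>E (Y \<rightarrow>\<^sub>E nonempty_sets)" and G: "G \<in> X \<rightarrow>\<^sub>E (Z \<rightarrow>\<^sub>E nonempty_sets)"
  shows "((Y, F), (Z, G)) \<in> le SW X \<longleftrightarrow>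
    (\<exists>h\<in>hom M (times X Y) (times X Z). Comp M (Pr1 M X Z) h = Pr1 M X Y \<and>
      (uncurry X Y F, rdx sW h (uncurry X Z G)) \<in> le sW (times X Y))"
proof
  assume "((Y, F), (Z, G)) \<in> le SW X"
  then obtain k e where k: "k \<in> computable_funs app A' (times X Y) Z" and e: "e \<in> A'"
    and FG: "\<And>x y q. x \<in> X \<Longrightarrow> y \<in> Y \<Longrightarrow> q \<in> G x (k (pair x y)) \<Longrightarrow> app_in app e q (F x y)"
    by (auto simp: SW_preorder_def)
  let ?h = "\<lambda>z\<in>times X Y. pair (pfst z) (k z)"
  have "?h \<in> computable_funs app A' (times X Y) (times X Z)"
    using k by (intro restrict_computable computable_pair computable_pfst)
      (auto simp: computable_funs_mem computable_funs_iff)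
  then have h: "Arrow (times X Y) ?h (times X Z) \<in> hom M (times X Y) (times X Z)"
    by simp
  moreover have "Comp M (Pr1 M X Z) (Arrow (times X Y) ?h (times X Z)) = Pr1 M X Y"
    by (auto simp: Pr1_M compose_def fun_eq_iff computable_funs_mem[OF k])
  moreover have "(uncurry X Y F, rdx sW (Arrow (times X Y) ?h (times X Z)) (uncurry X Z G))
      \<in> le sW (times X Y)"
    using uncurry_fib[OF F] sW.rdx_fib[OF h uncurry_fib[OF G]]
    unfolding sW_preorder_def
    by (simp, intro bexI[OF _ e])
      (auto simp: uncurry_def compose_def computable_funs_mem[OF k] intro!: FG)
  ultimately show "\<exists>h\<in>hom M (times X Y) (times X Z). Comp M (Pr1 M X Z) h = Pr1 M X Y \<and>
      (uncurry X Y F, rdx sW h (uncurry X Z G)) \<in> le sW (times X Y)"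
    by blast
next
  assume "\<exists>h\<in>hom M (times X Y) (times X Z). Comp M (Pr1 M X Z) h = Pr1 M X Y \<and>
      (uncurry X Y F, rdx sW h (uncurry X Z G)) \<in> le sW (times X Y)"
  then obtain h where h: "h \<in> computable_funs app A' (times X Y) (times X Z)"
    and vert: "Comp M (Pr1 M X Z) (Arrow (times X Y) h (times X Z)) = Pr1 M X Y"
    and le: "(uncurry X Y F, rdx sW (Arrow (times X Y) h (times X Z)) (uncurry X Z G))
      \<in> le sW (times X Y)"
    by (auto simp: hom_iff)
  define k where "k = (\<lambda>z\<in>times X Y. psnd (h z))"
  \<comment> \<open>Verticality, evaluated at a pair, says that \<open>h\<close> leaves the first
    coordinate unchanged.\<close>
  have hxy: "h (pair x y) = pair x (k (pair x y))" "k (pair x y) \<in> Z"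
    if xy: "x \<in> X" "y \<in> Y" for x y
  proof -
    have z: "pair x y \<in> times X Y" using xy by simp
    from computable_funs_mem[OF h z] obtain a b where ab: "h (pair x y) = pair a b" "a \<in> X" "b \<in> Z"
      by auto
    have "compose (times X Y) (\<lambda>z\<in>times X Z. pfst z) h (pair x y) =
          (\<lambda>z\<in>times X Y. pfst z) (pair x y)"
      using vert by (simp add: Pr1_M)
    with ab xy show "h (pair x y) = pair x (k (pair x y))" "k (pair x y) \<in> Z"
      by (simp_all add: compose_def k_def)
  qed
  have k: "k \<in> computable_funs app A' (times X Y) Z"
    unfolding k_def
  proof (rule restrict_computable)
    show "psnd (h z) \<in> Z" if "z \<in> times X Y" for z
      using computable_funs_mem[OF h that] by auto
    show "computable_on (times X Y) (\<lambda>z. psnd (h z))"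
      using h by (intro computable_comp[OF _ computable_psnd[of X Z]])
        (auto simp: computable_funs_iff computable_funs_mem[OF h])
  qed
  obtain e where e: "e \<in> A'" and FG: "\<And>p q. p \<in> times X Y \<Longrightarrow>
      q \<in> compose (times X Y) (uncurry X Z G) h p \<Longrightarrow> app_in app e q (uncurry X Y F p)"
    using le by (auto simp: sW_preorder_def)
  have "app_in app e q (F x y)" if "x \<in> X" "y \<in> Y" "q \<in> G x (k (pair x y))" for x y q
    using FG[of "pair x y" q] that hxy[OF that(1,2)] by (simp add: compose_def uncurry_def)
  with F G show "((Y, F), (Z, G)) \<in> le SW X"
    by (auto simp: SW_preorder_def gen_Weihrauch_preds_def intro!: bexI[OF _ k] bexI[OF _ e])
qed

text \<open>Both orders quantify over the same vertical arrows. For each of them \<open>step\<close>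
  removes the inner quotient, which leaves the comparison of uncurried predicates.\<close>

lemma ex_class_le:
  assumes a: "a \<in> fib SW X" and b: "b \<in> fib SW X"
  shows "(a, b) \<in> le SW X \<longleftrightarrow> (ex_class X a, ex_class X b) \<in> le sWex X"
proof -
  obtain Y F where a': "a = (Y, F)" and F: "F \<in> X \<rightarrow>\<^sub>E (Y \<rightarrow>\<^sub>E nonempty_sets)"
    using a by (cases a) (auto simp: SW_preorder_def gen_Weihrauch_preds_def)
  obtain Z G where b': "b = (Z, G)" and G: "G \<in> X \<rightarrow>\<^sub>E (Z \<rightarrow>\<^sub>E nonempty_sets)"
    using b by (cases b) (auto simp: SW_preorder_def gen_Weihrauch_preds_def)
  let ?f = "uncurry X Y F" and ?g = "uncurry X Z G"
  let ?R = "poset_reflection M sW"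
  have step: "(equiv_of sW (times X Y) `` {?f}, rdx ?R h (equiv_of sW (times X Z) `` {?g}))
        \<in> le ?R (times X Y) \<longleftrightarrow> (?f, rdx sW h ?g) \<in> le sW (times X Y)"
    if "h \<in> hom M (times X Y) (times X Z)" for h
    using that uncurry_fib[OF F] uncurry_fib[OF G]
    by (simp add: sW.rdx_class sW.class_le_iff sW.rdx_fib)
  show ?thesis
    using ex_class_fib[OF a] ex_class_fib[OF b] step
    by (auto simp: a' b' SW_le_iff_vertical[OF F G] ex_class_def ex_preorder_def Prod_M
        elementary_strong_Weihrauch_def)
qed

text \<open>Before taking classes the two predicates are already equal: each sends
  \<open>pair x y\<close> to the value of \<open>F\<close> at \<open>f x\<close> and
  \<open>y\<close>.\<close>

lemma ex_class_natural:
  assumes u: "u \<in> hom M X' X" and a: "a \<in> fib SW X"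
  shows "ex_class X' (rdx SW u a) = rdx sWex u (ex_class X a)"
proof -
  obtain f where f: "f \<in> computable_funs app A' X' X" "u = Arrow X' f X"
    using u by (auto simp: hom_iff)
  obtain Y F where a': "a = (Y, F)" and F: "F \<in> X \<rightarrow>\<^sub>E (Y \<rightarrow>\<^sub>E nonempty_sets)"
    using a by (cases a) (auto simp: SW_preorder_def gen_Weihrauch_preds_def)
  let ?v = "prod_map M u (Ident M Y)"
  have v: "?v \<in> hom M (times X' Y) (times X Y)"
    using prod_map_hom[OF u ident_hom[OF Obj_M]] by (simp add: Prod_M)
  \<comment> \<open>Reindexing in \<open>sW\<close> restricts to the source of the arrow, so this
    makes both sides undefined at the same arguments.\<close>
  then have "src ?v = times X' Y" by (auto simp: hom_iff)
  then have "uncurry X' Y (compose X' F f) = rdx sW ?v (uncurry X Y F)"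
    using fn_prod_map[OF f(1)]
    by (auto simp: sW_preorder_def uncurry_def compose_def fun_eq_iff f(2)
        computable_funs_mem[OF f(1)])
  then show ?thesis
    by (simp add: a' ex_class_def ex_preorder_def elementary_strong_Weihrauch_def
        sW.rdx_class[OF v uncurry_fib[OF F]])
      (simp add: SW_preorder_def f(2))
qed

text \<open>Both doctrines unfold to reflections, of \<open>SW\<close> and of \<open>sWex\<close>,
  which \<open>ex_class\<close> compares. What remains to be checked directly for \<open>SW\<close>
  is the typing and strict functoriality of precomposition.\<close>

theorem isomorphic_strong_Weihrauch:
  "isomorphic_doctrines M (strong_Weihrauch app A' pr p1 p2)
     (pure_existential_completion M (elementary_strong_Weihrauch app A' pr p1 p2))"
  unfolding strong_Weihrauch_def pure_existential_completion_def
proof (rule sWex.isomorphic_poset_reflections[where \<phi> = ex_class])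
  show "a \<in> fib SW X \<and> b \<in> fib SW X" if "(a, b) \<in> le SW X" for X a b
    using that by (auto simp: SW_preorder_def)
  show "rdx SW u b \<in> fib SW X" if "u \<in> hom M X Y" "b \<in> fib SW Y" for u X Y b
    using that
    by (clarsimp simp: SW_preorder_def gen_Weihrauch_preds_def hom_iff) (erule (1) compose_PiE)
  show "rdx SW (Ident M X) a = a" if fib: "a \<in> fib SW X" for X a
  proof -
    obtain Y F where a: "a = (Y, F)" and F: "F \<in> X \<rightarrow>\<^sub>E (Y \<rightarrow>\<^sub>E nonempty_sets)"
      using fib by (cases a) (auto simp: SW_preorder_def gen_Weihrauch_preds_def)
    have "compose X F (\<lambda>x\<in>X. x) x = F x" for x
      by (cases "x \<in> X") (simp_all add: compose_def PiE_arb[OF F])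
    then show ?thesis by (auto simp: a SW_preorder_def Ident_M)
  qed
  show "rdx SW (Comp M v u) d = rdx SW u (rdx SW v d)"
    if "u \<in> hom M X Y" "v \<in> hom M Y Z" for u v X Y Z d
    using that
    by (cases d)
       (auto simp: SW_preorder_def hom_iff compose_def fun_eq_iff computable_funs_mem)
qed (simp_all add: ex_class_fib ex_class_surj ex_class_natural ex_class_le)

end

theorem theorem5p18:
  fixes app :: "'a \<Rightarrow> 'a \<Rightarrow> 'a option"
    and A' :: "'a set"
    and pr p1 p2 :: 'a
  assumes "pca app"
    and "elementary_sub_pca app A'"
    and "pairing_elements app A' pr p1 p2"
  shows "isomorphic_doctrines (Mod_p app A' pr p1 p2)
           (strong_Weihrauch app A' pr p1 p2)
           (pure_existential_completion (Mod_p app A' pr p1 p2)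
              (elementary_strong_Weihrauch app A' pr p1 p2))"
proof -
  interpret elementary_pca app A' pr p1 p2
    using assms(2,3) by unfold_locales
  show ?thesis by (rule isomorphic_strong_Weihrauch)
qed

end
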